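(* For all $n\geq 3$, the number $C_n(123,132)$ of cyclic permutations of length $n$ avoiding both patterns $123$ and $132$ equals $2^{\lfloor (n-1)/2\rfloor}$.
   Context: A permutation of length $n$ is a linear order $p=p_1p_2\cdots p_n$ of $[n]=\{1,\dots,n\}$, also viewed as the bijection $i\mapsto p_i$. It is cyclic if, as a bijection of $[n]$, it consists of a single cycle of length $n$. A permutation $p$ contains a pattern $q=q_1\cdots q_k$ if there are indices $i_1<\cdots<i_k$ such that for all $j,r$, $q_j<q_r$ iff $p_{i_j}<p_{i_r}$; otherwise $p$ avoids $q$. *)

theory Defs
  imports "HOL-Combinatorics.Combinatorics"
begin

text \<open>
  A permutation of length \<open>n\<close> is a function \<open>p\<close> with \<open>p permutes {1..n}\<close>, so that \<open>p\<close> is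
  the identity outside \<open>{1..n}\<close> and distinct permutations are distinct functions. A pattern
  is given in one-line notation as a list; its entries are therefore indexed from 0, while
  the positions \<open>idx j\<close> in the permutation range over \<open>{1..n}\<close>.
\<close>

definition contains_pattern :: "nat \<Rightarrow> (nat \<Rightarrow> nat) \<Rightarrow> nat list \<Rightarrow> bool" where
  "contains_pattern n p q \<longleftrightarrow>
     (\<exists>idx :: nat \<Rightarrow> nat.
        strict_mono_on {..<length q} idx \<and>
        idx ` {..<length q} \<subseteq> {1..n} \<and>
        (\<forall>j<length q. \<forall>r<length q. q ! j < q ! r \<longleftrightarrow> p (idx j) < p (idx r)))"

definition avoids_pattern :: "nat \<Rightarrow> (nat \<Rightarrow> nat) \<Rightarrow> nat list \<Rightarrow> bool" where
  "avoids_pattern n p q \<longleftrightarrow> \<not> contains_pattern n p q"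

definition cyclic_permutation :: "nat \<Rightarrow> (nat \<Rightarrow> nat) \<Rightarrow> bool" where
  "cyclic_permutation n p \<longleftrightarrow> p permutes {1..n} \<and> cyclic_on p {1..n}"

definition num_cyclic_avoiding :: "nat \<Rightarrow> nat list set \<Rightarrow> nat" where
  "num_cyclic_avoiding n Q = card {p. cyclic_permutation n p \<and> (\<forall>q\<in>Q. avoids_pattern n p q)}"

end

theory Submission
  imports Defs
begin

text \<open>
  A permutation avoids 123 and 132 iff no entry has two larger entries to its right, a condition
  that is invariant under inversion. It forces \<open>1\<close> into one of the last two positions and \<open>p 1\<close>
  into the two largest values; excluding 2-cycles, a cyclic avoider of \<open>{1..n}\<close>, \<open>n \<ge> 3\<close>,
  satisfies exactly one of \<open>p 1 = n\<close> and \<open>p n = 1\<close>. Inversion exchanges the two classes. In the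
  first class the cycle runs through \<open>n - 1 \<mapsto> 1 \<mapsto> n\<close>, and bypassing \<open>1\<close> and \<open>n\<close> is a
  bijection onto the cyclic avoiders of \<open>{2..n - 1}\<close>. So the count doubles when \<open>n\<close> grows by 2.
\<close>

section \<open>Cycles described by their invariant subsets\<close>

text \<open>The orbit of a point is the least invariant set that contains its image, so being a
  single orbit amounts to having no smaller nonempty invariant subset. Later arguments about cycles
  then only handle subsets.\<close>

lemma cyclic_on_iff_minimal_invariant:
  "cyclic_on f S \<longleftrightarrow> S \<noteq> {} \<and> f ` S \<subseteq> S \<and> (\<forall>T\<subseteq>S. T \<noteq> {} \<longrightarrow> f ` T \<subseteq> T \<longrightarrow> T = S)"
proof -
  have orbit_sub: "orbit f s \<subseteq> T" if "s \<in> T" "f ` T \<subseteq> T" for s T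
  proof
    fix x assume "x \<in> orbit f s"
    then show "x \<in> T" by induction (use that in auto)
  qed
  have orbit_inv: "f ` orbit f s \<subseteq> orbit f s" "f s \<in> orbit f s" for s
    by (auto intro: orbit.intros)
  show ?thesis
  proof (intro iffI conjI allI impI)
    assume c: "cyclic_on f S"
    then show "S \<noteq> {}" by (auto simp: cyclic_on_def)
    show "f ` S \<subseteq> S" using c orbit_inv(1) by (auto simp: cyclic_on_def)
    fix T assume T: "T \<subseteq> S" "T \<noteq> {}" "f ` T \<subseteq> T"
    then obtain t where t: "t \<in> T" by blast
    with T have "t \<in> S" by blast
    then have "S = orbit f t" using c unfolding cyclic_on_alldef by blast
    with orbit_sub[OF t T(3)] T(1) show "T = S" by blast
  next
    assume *: "S \<noteq> {} \<and> f ` S \<subseteq> S \<and> (\<forall>T\<subseteq>S. T \<noteq> {} \<longrightarrow> f ` T \<subseteq> T \<longrightarrow> T = S)"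
    then obtain s where s: "s \<in> S" by blast
    have "orbit f s \<subseteq> S" using * orbit_sub[OF s] by blast
    moreover have "orbit f s \<noteq> {}" using orbit_inv(2) by blast
    ultimately have "orbit f s = S"
      using *[THEN conjunct2, THEN conjunct2, rule_format, OF _ _ orbit_inv(1)] by simp
    with s show "cyclic_on f S" by (intro cyclic_on_singleI[of s]) simp_all
  qed
qed

lemma cyclic_on_id_singleton: "cyclic_on id {a}"
  unfolding cyclic_on_iff_minimal_invariant by (simp add: subset_singleton_iff)

lemma cyclic_on_two_cycle:
  assumes "cyclic_on p S" "x \<in> S" "p x = y" "p y = x"
  shows "S = {x, y}"
proof -
  have "y \<in> S" using cyclic_on_inI[OF assms(1,2)] assms(3) by simp
  then have "{x, y} = S"
    using assms(1)[unfolded cyclic_on_iff_minimal_invariant, THEN conjunct2, THEN conjunct2,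
        rule_format, of "{x, y}"] assms(2-4) by simp
  then show ?thesis by simp
qed

text \<open>Composing with the transposition splices \<open>y\<close> into the cycle directly after
  \<open>x\<close>, giving \<open>x\<close>, \<open>y\<close>, \<open>f x\<close>. Invariant sets of
  the two maps correspond by adding or removing \<open>y\<close>.\<close>

lemma cyclic_on_comp_transpose_iff:
  assumes f: "f permutes S" and x: "x \<in> S" and y: "y \<notin> S"
  shows "cyclic_on (f \<circ> transpose x y) (insert y S) \<longleftrightarrow> cyclic_on f S"
proof -
  define g where "g = f \<circ> transpose x y"
  have gx: "g x = y" and gy: "g y = f x"
    using f y by (auto simp: g_def permutes_not_in)
  have gz: "g z = f z" if "z \<noteq> x" "z \<noteq> y" for z
    using that by (simp add: g_def transpose_def)
  have fS: "f z \<in> S" if "z \<in> S" for z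
    using f that by (simp add: permutes_in_image)
  have g_sub: "g ` insert y S \<subseteq> insert y S"
    using fS gx gy gz x by (metis image_subsetI insert_iff)
  have "cyclic_on g (insert y S) \<longleftrightarrow> cyclic_on f S"
  proof
    assume c: "cyclic_on g (insert y S)"
    have "T = S" if T: "T \<subseteq> S" "T \<noteq> {}" "f ` T \<subseteq> T" for T
    proof -
      \<comment> \<open>The new map sends \<open>x\<close> to \<open>y\<close>, so \<open>y\<close>
        has to join exactly when \<open>x\<close> is present; \<open>y\<close> then goes to
        \<open>f x\<close>, which is already in \<open>T\<close>.\<close>
      define T' where "T' = T \<union> (if x \<in> T then {y} else {})"
      have "g z \<in> T'" if "z \<in> T'" for z
      proof (cases "z = x \<or> z = y")
        case True
        then show ?thesis using that T y gx gy by (auto simp: T'_def split: if_splits)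
      next
        case False
        then show ?thesis using that T gz[of z] by (auto simp: T'_def split: if_splits)
      qed
      then have "g ` T' \<subseteq> T'" by blast
      moreover have "T' \<subseteq> insert y S" "T' \<noteq> {}" using T by (auto simp: T'_def)
      ultimately have "T' = insert y S"
        using c unfolding cyclic_on_iff_minimal_invariant by blast
      then show ?thesis using T y by (auto simp: T'_def split: if_splits)
    qed
    then show "cyclic_on f S"
      unfolding cyclic_on_iff_minimal_invariant using x fS by blast
  next
    assume c: "cyclic_on f S"
    have "T = insert y S" if T: "T \<subseteq> insert y S" "T \<noteq> {}" "g ` T \<subseteq> T" for T
    proof -
      have gT: "g z \<in> T" if "z \<in> T" for z using T that by blast
      \<comment> \<open>For \<open>z = x\<close>, the value \<open>f x\<close> is reached by two
        steps of \<open>g\<close>, passing through \<open>y\<close>.\<close>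
      have "f z \<in> T - {y}" if "z \<in> T - {y}" for z
      proof -
        have "z \<in> S" using that T by blast
        then have "f z \<in> S" by (rule fS)
        moreover have "f z \<in> T"
          using that gT[of z] gT[of y] gx gy gz[of z] by (cases "z = x") auto
        ultimately show ?thesis using y by blast
      qed
      moreover have "T - {y} \<noteq> {}"
      proof
        assume "T - {y} = {}"
        with T have "y \<in> T" by blast
        with gT have "f x \<in> T" using gy by metis
        with \<open>T - {y} = {}\<close> fS[OF x] y show False by blast
      qed
      moreover have "T - {y} \<subseteq> S" using T by blast
      ultimately have "T - {y} = S"
        using c unfolding cyclic_on_iff_minimal_invariant by (metis image_subsetI)
      moreover from this have "y \<in> T" using x gT[of x] gx by auto
      ultimately show ?thesis by blast
    qed
    then show "cyclic_on g (insert y S)"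
      unfolding cyclic_on_iff_minimal_invariant using g_sub by blast
  qed
  then show ?thesis by (simp add: g_def)
qed

text \<open>On a finite set, an invariant subset of the injective map \<open>inv p\<close> is mapped
  onto itself, hence is invariant under \<open>p\<close> as well.\<close>

lemma cyclic_on_inv:
  assumes p: "p permutes S" and c: "cyclic_on p S"
  shows "cyclic_on (inv p) S"
  unfolding cyclic_on_iff_minimal_invariant
proof (intro conjI allI impI)
  show "S \<noteq> {}" using c by (simp add: cyclic_on_iff_minimal_invariant)
  show "inv p ` S \<subseteq> S" using permutes_image[OF permutes_inv[OF p]] by simp
  fix T assume T: "T \<subseteq> S" "T \<noteq> {}" "inv p ` T \<subseteq> T"
  have "finite T" using T(1) finite_cyclic_on[OF c] by (rule finite_subset)
  moreover have "inj_on (inv p) T" using permutes_inj_on[OF permutes_inv[OF p]] .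
  ultimately have "inv p ` T = T" using T(3) by (simp add: endo_inj_surj)
  then have "p ` T = T" using p by (metis image_inv_f_f image_f_inv_f permutes_surj)
  with T c show "T = S" by (simp add: cyclic_on_iff_minimal_invariant)
qed

section \<open>Avoidance of 123 and 132 as a symmetric condition\<close>

text \<open>The positions \<open>j\<close> and \<open>k\<close> are not ordered relative to each
  other, so positions and values enter in the same way; this makes the invariance under inversion
  immediate. The set \<open>S\<close> is a parameter because the recursion passes to shorter
  intervals.\<close>

definition at_most_one_larger_right :: "'a::linorder set \<Rightarrow> ('a \<Rightarrow> 'b::linorder) \<Rightarrow> bool" where
  "at_most_one_larger_right S p \<longleftrightarrow>
     (\<forall>i\<in>S. \<forall>j\<in>S. \<forall>k\<in>S. i < j \<longrightarrow> i < k \<longrightarrow> p i < p j \<longrightarrow> p i < p k \<longrightarrow> j = k)"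

lemma at_most_one_larger_rightD:
  "at_most_one_larger_right S p \<Longrightarrow> i \<in> S \<Longrightarrow> j \<in> S \<Longrightarrow> k \<in> S \<Longrightarrow>
     i < j \<Longrightarrow> i < k \<Longrightarrow> p i < p j \<Longrightarrow> p i < p k \<Longrightarrow> j = k"
  unfolding at_most_one_larger_right_def by blast

lemma at_most_one_larger_right_inv:
  assumes "p permutes S" "at_most_one_larger_right S p"
  shows "at_most_one_larger_right S (inv p)"
  unfolding at_most_one_larger_right_def
proof (intro ballI impI)
  fix x y z
  assume S: "x \<in> S" "y \<in> S" "z \<in> S"
    and "x < y" "x < z" "inv p x < inv p y" "inv p x < inv p z"
  moreover have "inv p x \<in> S" "inv p y \<in> S" "inv p z \<in> S"
    using S assms(1) by (simp_all add: permutes_in_image permutes_inv)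
  ultimately have "inv p y = inv p z"
    using at_most_one_larger_rightD[OF assms(2), of "inv p x" "inv p y" "inv p z"]
    by (simp add: permutes_inverses[OF assms(1)])
  then show "y = z" using assms(1) by (metis permutes_inverses(1))
qed

text \<open>Unfolds the index function into three positions; the six comparisons are the
  off-diagonal pairs, since the diagonal ones hold trivially.\<close>

lemma contains_pattern_length_3_iff:
  "contains_pattern n p [u, v, w] \<longleftrightarrow>
     (\<exists>i\<in>{1..n}. \<exists>j\<in>{1..n}. \<exists>k\<in>{1..n}. i < j \<and> j < k \<and>
       (u < v \<longleftrightarrow> p i < p j) \<and> (v < u \<longleftrightarrow> p j < p i) \<and> (u < w \<longleftrightarrow> p i < p k) \<and>
       (w < u \<longleftrightarrow> p k < p i) \<and> (v < w \<longleftrightarrow> p j < p k) \<and> (w < v \<longleftrightarrow> p k < p j))"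
  (is "?L \<longleftrightarrow> ?R")
proof -
  have three: "{..<length [u, v, w]} = {0, 1, 2}" by auto
  have all3: "(\<forall>j<length [u, v, w]. P j) \<longleftrightarrow> P 0 \<and> P 1 \<and> P 2" for P :: "nat \<Rightarrow> bool"
    by (auto simp: less_Suc_eq numeral_2_eq_2)
  show ?thesis
  proof
    assume ?L
    then obtain idx where idx: "strict_mono_on {0, 1, 2::nat} idx" "idx ` {0, 1, 2} \<subseteq> {1..n}"
      "\<forall>j<length [u, v, w]. \<forall>r<length [u, v, w].
         [u, v, w] ! j < [u, v, w] ! r \<longleftrightarrow> p (idx j) < p (idx r)"
      unfolding contains_pattern_def three by blast
    have "idx 0 < idx 1" "idx 1 < idx 2"
      using idx(1) by (auto simp: strict_mono_on_def)
    moreover have "idx 0 \<in> {1..n}" "idx 1 \<in> {1..n}" "idx 2 \<in> {1..n}" using idx(2) by blast+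
    moreover have "(u < v \<longleftrightarrow> p (idx 0) < p (idx 1)) \<and> (v < u \<longleftrightarrow> p (idx 1) < p (idx 0)) \<and>
        (u < w \<longleftrightarrow> p (idx 0) < p (idx 2)) \<and> (w < u \<longleftrightarrow> p (idx 2) < p (idx 0)) \<and>
        (v < w \<longleftrightarrow> p (idx 1) < p (idx 2)) \<and> (w < v \<longleftrightarrow> p (idx 2) < p (idx 1))"
      using idx(3)[unfolded all3] by simp
    ultimately show ?R by blast
  next
    assume ?R
    then obtain i j k where ijk: "i \<in> {1..n}" "j \<in> {1..n}" "k \<in> {1..n}" "i < j" "j < k"
      "(u < v \<longleftrightarrow> p i < p j) \<and> (v < u \<longleftrightarrow> p j < p i) \<and> (u < w \<longleftrightarrow> p i < p k) \<and>
       (w < u \<longleftrightarrow> p k < p i) \<and> (v < w \<longleftrightarrow> p j < p k) \<and> (w < v \<longleftrightarrow> p k < p j)"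
      by blast
    define idx where "idx = (!) [i, j, k]"
    have idx_simps: "idx 0 = i" "idx 1 = j" "idx 2 = k" by (simp_all add: idx_def)
    have "strict_mono_on {0, 1, 2::nat} idx" "idx ` {0, 1, 2} \<subseteq> {1..n}"
      using ijk by (auto simp: strict_mono_on_def idx_simps simp flip: One_nat_def)
    moreover have "\<forall>j<length [u, v, w]. \<forall>r<length [u, v, w].
         [u, v, w] ! j < [u, v, w] ! r \<longleftrightarrow> p (idx j) < p (idx r)"
      unfolding all3 idx_simps using ijk(6) by simp
    ultimately show ?L unfolding contains_pattern_def three by blast
  qed
qed

text \<open>The two patterns differ only in the order of their two larger entries, so together they
  forbid a smaller entry followed by any two larger ones.\<close>

lemma avoids_123_132_iff:
  assumes "p permutes {1..n}"
  shows "(\<forall>q\<in>{[1, 2, 3], [1, 3, 2]}. avoids_pattern n p q) \<longleftrightarrow>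
           at_most_one_larger_right {1..n} p"
proof -
  have "contains_pattern n p [1, 2, 3] \<or> contains_pattern n p [1, 3, 2] \<longleftrightarrow>
        (\<exists>i\<in>{1..n}. \<exists>j\<in>{1..n}. \<exists>k\<in>{1..n}. i < j \<and> j < k \<and> p i < p j \<and> p i < p k)" (is "_ \<longleftrightarrow> ?R")
  proof
    assume "contains_pattern n p [1, 2, 3] \<or> contains_pattern n p [1, 3, 2]"
    then show ?R unfolding contains_pattern_length_3_iff by auto
  next
    assume ?R
    then obtain i j k where ijk: "i \<in> {1..n}" "j \<in> {1..n}" "k \<in> {1..n}" "i < j" "j < k"
      "p i < p j" "p i < p k" by blast
    have "p j \<noteq> p k" using permutes_inj[OF assms] ijk(5) by (auto dest: injD)
    then consider "p j < p k" | "p k < p j" by linarith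
    then show "contains_pattern n p [1, 2, 3] \<or> contains_pattern n p [1, 3, 2]"
    proof cases
      case 1
      with ijk show ?thesis
        unfolding contains_pattern_length_3_iff
        by (intro disjI1 bexI[of _ i] bexI[of _ j] bexI[of _ k]) auto
    next
      case 2
      with ijk show ?thesis
        unfolding contains_pattern_length_3_iff
        by (intro disjI2 bexI[of _ i] bexI[of _ j] bexI[of _ k]) auto
    qed
  qed
  moreover have "?R \<longleftrightarrow> \<not> at_most_one_larger_right {1..n} p"
  proof
    assume ?R
    then obtain i j k where "i \<in> {1..n}" "j \<in> {1..n}" "k \<in> {1..n}" "i < j" "j < k"
      "p i < p j" "p i < p k" by blast
    then show "\<not> at_most_one_larger_right {1..n} p"
      using at_most_one_larger_rightD[of "{1..n}" p i j k] by auto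
  next
    assume "\<not> at_most_one_larger_right {1..n} p"
    then obtain i j k where "i \<in> {1..n}" "j \<in> {1..n}" "k \<in> {1..n}"
      "i < j" "i < k" "p i < p j" "p i < p k" "j \<noteq> k"
      unfolding at_most_one_larger_right_def by blast
    then show ?R by (metis linorder_neqE_nat)
  qed
  ultimately show ?thesis by (auto simp: avoids_pattern_def)
qed

section \<open>Cyclic avoiders of an interval and their extreme values\<close>

text \<open>Both endpoints vary because each reduction removes the least and the greatest point,
  with no relabelling.\<close>

definition cyclic_avoiders :: "nat \<Rightarrow> nat \<Rightarrow> (nat \<Rightarrow> nat) set" where
  "cyclic_avoiders a b =
     {p. p permutes {a..b} \<and> cyclic_on p {a..b} \<and> at_most_one_larger_right {a..b} p}"

lemma finite_cyclic_avoiders: "finite (cyclic_avoiders a b)"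
  by (rule finite_subset[OF _ finite_permutations[of "{a..b}"]]) (auto simp: cyclic_avoiders_def)

lemma inv_cyclic_avoiders: "p \<in> cyclic_avoiders a b \<Longrightarrow> inv p \<in> cyclic_avoiders a b"
  by (auto simp: cyclic_avoiders_def permutes_inv at_most_one_larger_right_inv
      intro: cyclic_on_inv)

text \<open>If the minimum \<open>a\<close> stood further left, the entries at \<open>b - 1\<close>
  and \<open>b\<close> would be two larger ones to its right.\<close>

lemma cyclic_avoiders_min_position:
  assumes p: "p \<in> cyclic_avoiders a b" and ab: "a + 2 \<le> b"
  shows "p b = a \<or> p (b - 1) = a"
proof -
  have perm: "p permutes {a..b}" and av: "at_most_one_larger_right {a..b} p"
    using p by (auto simp: cyclic_avoiders_def)
  define k where "k = inv p a"
  have pk: "p k = a" by (simp add: k_def permutes_inverses[OF perm])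
  have k: "k \<in> {a..b}" using ab permutes_in_image[OF permutes_inv[OF perm], of a] by (simp add: k_def)
  have gt: "p j > a" if "j \<in> {a..b}" "j \<noteq> k" for j
  proof -
    have "p j \<in> {a..b}" using that perm by (simp only: permutes_in_image)
    moreover have "p j \<noteq> a" using that pk permutes_inj[OF perm] by (metis injD)
    ultimately show ?thesis by simp
  qed
  have "\<not> k < b - 1"
  proof
    assume "k < b - 1"
    then have "b - 1 = b"
      using at_most_one_larger_rightD[OF av k, of "b - 1" b] gt[of b] gt[of "b - 1"] ab pk by simp
    with ab show False by simp
  qed
  then have "k = b \<or> k = b - 1" using k by auto
  then show ?thesis using pk by auto
qed

lemma cyclic_avoiders_not_two_cycle:
  assumes "p \<in> cyclic_avoiders a b" "a + 2 \<le> b" "x \<in> {a..b}" "p x = y" "p y = x"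
  shows False
proof -
  have "{a..b} = {x, y}"
    using assms by (intro cyclic_on_two_cycle[of p]) (auto simp: cyclic_avoiders_def)
  then have "card {a..b} \<le> 2" by (simp add: card_insert_if)
  then show False using assms(2) by simp
qed

text \<open>The position of the minimum in \<open>inv p\<close> confines \<open>p a\<close> to
  \<open>b\<close> and \<open>b - 1\<close>, just as \<open>a\<close> is confined to positions
  \<open>b\<close> and \<open>b - 1\<close>. Choosing the same point in both alternatives would
  create a 2-cycle.\<close>

lemma cyclic_avoiders_extremes:
  assumes p: "p \<in> cyclic_avoiders a b" and ab: "a + 2 \<le> b"
  shows "p a = b \<longleftrightarrow> p b \<noteq> a"
proof -
  have perm: "p permutes {a..b}" using p by (simp add: cyclic_avoiders_def)
  have "inv p b = a \<or> inv p (b - 1) = a"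
    using cyclic_avoiders_min_position[OF inv_cyclic_avoiders[OF p] ab] .
  then have "p a = b \<or> p a = b - 1" using perm by (metis permutes_inverses(1))
  moreover have "\<not> (p a = y \<and> p y = a)" for y
    using cyclic_avoiders_not_two_cycle[OF p ab, of a y] ab by auto
  ultimately show ?thesis using cyclic_avoiders_min_position[OF p ab] by blast
qed

section \<open>Inserting the two extreme points\<close>

text \<open>Inserts the extreme points \<open>a\<close> and \<open>b\<close> into the cycle right after \<open>b - 1\<close>.\<close>

definition lift_perm :: "nat \<Rightarrow> nat \<Rightarrow> (nat \<Rightarrow> nat) \<Rightarrow> nat \<Rightarrow> nat" where
  "lift_perm a b p = p \<circ> transpose (b - 1) b \<circ> transpose (b - 1) a"

lemma lift_perm_apply:
  assumes p: "p permutes {Suc a..b - 1}" and ab: "a + 2 \<le> b"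
  shows "lift_perm a b p a = b" "lift_perm a b p (b - 1) = a" "lift_perm a b p b = p (b - 1)"
    "x \<notin> {a, b - 1, b} \<Longrightarrow> lift_perm a b p x = p x"
  using ab permutes_not_in[OF p, of a] permutes_not_in[OF p, of b]
  by (auto simp: lift_perm_def transpose_def)

lemma inj_lift_perm: "inj (lift_perm a b)"
proof (rule injI)
  fix p q assume "lift_perm a b p = lift_perm a b q"
  then have "lift_perm a b p \<circ> transpose (b - 1) a \<circ> transpose (b - 1) b =
             lift_perm a b q \<circ> transpose (b - 1) a \<circ> transpose (b - 1) b" by simp
  then show "p = q" by (simp add: lift_perm_def comp_assoc)
qed

lemma insert_extremes:
  assumes "a + 2 \<le> b"
  shows "insert a (insert b {Suc a..b - 1}) = {a..b}"
  using assms by auto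

lemma lift_perm_permutes:
  assumes p: "p permutes {Suc a..b - 1}" and ab: "a + 2 \<le> b"
  shows "lift_perm a b p permutes {a..b}"
  unfolding lift_perm_def using ab permutes_subset[OF p, of "{a..b}"]
  by (intro permutes_compose permutes_swap_id) auto

text \<open>Two splices: first \<open>b\<close> after \<open>b - 1\<close>, then \<open>a\<close>
  after \<open>b - 1\<close>, which puts \<open>a\<close> in front of \<open>b\<close>.\<close>

lemma cyclic_on_lift_perm_iff:
  assumes p: "p permutes {Suc a..b - 1}" and ab: "a + 2 \<le> b"
  shows "cyclic_on (lift_perm a b p) {a..b} \<longleftrightarrow> cyclic_on p {Suc a..b - 1}"
proof -
  have "p \<circ> transpose (b - 1) b permutes insert b {Suc a..b - 1}"
    using ab permutes_subset[OF p, of "insert b {Suc a..b - 1}"]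
    by (intro permutes_compose permutes_swap_id) auto
  then have "cyclic_on (lift_perm a b p) (insert a (insert b {Suc a..b - 1})) \<longleftrightarrow>
        cyclic_on (p \<circ> transpose (b - 1) b) (insert b {Suc a..b - 1})"
    unfolding lift_perm_def using ab by (intro cyclic_on_comp_transpose_iff) auto
  also have "\<dots> \<longleftrightarrow> cyclic_on p {Suc a..b - 1}"
    using ab by (intro cyclic_on_comp_transpose_iff p) auto
  finally show ?thesis by (simp only: insert_extremes[OF ab])
qed

text \<open>The two new entries are harmless: the maximum \<open>b\<close> stands first and the
  minimum \<open>a\<close> stands last but one. The remaining entries keep their relative order, the
  last of them moving from position \<open>b - 1\<close> to \<open>b\<close>.\<close>

lemma at_most_one_larger_right_lift_perm_iff:
  assumes p: "p permutes {Suc a..b - 1}" and ab: "a + 2 \<le> b"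
  shows "at_most_one_larger_right {a..b} (lift_perm a b p) \<longleftrightarrow>
           at_most_one_larger_right {Suc a..b - 1} p"
proof
  define q where "q = lift_perm a b p"
  note q = lift_perm_apply[OF p ab, folded q_def]
  {
    assume av: "at_most_one_larger_right {a..b} q"
    \<comment> \<open>Position in the lifted permutation of the entry \<open>p x\<close>; it is
      increasing on the inner interval.\<close>
    define h where "h x = (if x = b - 1 then b else x)" for x
    have qh: "q (h x) = p x" "h x \<in> {a..b}" if "x \<in> {Suc a..b - 1}" for x
      using that q(3) q(4)[of x] by (auto simp: h_def)
    have h: "h x < h y" if "x \<in> {Suc a..b - 1}" "y \<in> {Suc a..b - 1}" "x < y" for x y
      using that by (auto simp: h_def)
    have "j = k" if "i \<in> {Suc a..b - 1}" "j \<in> {Suc a..b - 1}" "k \<in> {Suc a..b - 1}"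
      "i < j" "i < k" "p i < p j" "p i < p k" for i j k
    proof -
      have "h j = h k"
        using that by (intro at_most_one_larger_rightD[OF av, of "h i"])
          (simp_all only: qh h)
      with h that show ?thesis by (metis less_irrefl linorder_neqE_nat)
    qed
    then show "at_most_one_larger_right {Suc a..b - 1} p"
      unfolding at_most_one_larger_right_def by blast
  next
    assume av: "at_most_one_larger_right {Suc a..b - 1} p"
    have le: "q x \<le> b" if "x \<in> {a..b}" for x
      using lift_perm_permutes[OF p ab] that permutes_in_image[of q "{a..b}" x]
      by (simp add: q_def)
    \<comment> \<open>Inverse of the relocation: the entry at position \<open>b\<close> returns to
      \<open>b - 1\<close>.\<close>
    define g where "g x = (if x = b then b - 1 else x)" for x
    have "j = k" if ijk: "i \<in> {a..b}" "j \<in> {a..b}" "k \<in> {a..b}"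
      "i < j" "i < k" "q i < q j" "q i < q k" for i j k
    proof (cases "i \<ge> b - 1")
      case True
      with ijk show ?thesis by auto
    next
      case False
      \<comment> \<open>Position \<open>a\<close> carries the maximum, so nothing exceeds
        it.\<close>
      have i: "i \<noteq> a" using ijk le[of j] q(1) by auto
      have qi: "q i = p i" using False i q(4)[of i] by auto
      \<comment> \<open>A position with an entry larger than \<open>q i\<close> cannot be
        \<open>b - 1\<close>, which holds the minimum.\<close>
      have g: "g x \<in> {Suc a..b - 1}" "q x = p (g x)" "i < g x" "x \<noteq> b - 1"
        if x: "x \<in> {a..b}" "i < x" "q i < q x" for x
      proof -
        have "a \<le> q i"
          using lift_perm_permutes[OF p ab] ijk(1) permutes_in_image[of q "{a..b}" i]
          by (simp add: q_def)
        then show x1: "x \<noteq> b - 1" using x q(2) by auto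
        show "g x \<in> {Suc a..b - 1}" "i < g x" using x ijk False ab by (auto simp: g_def)
        show "q x = p (g x)" using x x1 ijk(1) q(3) q(4)[of x] by (auto simp: g_def)
      qed
      note gj = g[OF ijk(2,4,6)] and gk = g[OF ijk(3,5,7)]
      have "g j = g k"
        using ijk(1,6,7) i False gj gk qi
        by (intro at_most_one_larger_rightD[OF av, of i]) auto
      \<comment> \<open>The only positions that \<open>g\<close> identifies are \<open>b - 1\<close>
        and \<open>b\<close>, and \<open>b - 1\<close> is excluded.\<close>
      then show ?thesis using gj(4) gk(4) by (auto simp: g_def split: if_splits)
    qed
    then show "at_most_one_larger_right {a..b} q"
      unfolding at_most_one_larger_right_def by blast
  }
qed

lemma lift_perm_image_cyclic_avoiders:
  assumes ab: "a + 2 \<le> b"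
  shows "lift_perm a b ` cyclic_avoiders (Suc a) (b - 1) = {p \<in> cyclic_avoiders a b. p a = b}"
proof (intro equalityI subsetI)
  fix q assume "q \<in> lift_perm a b ` cyclic_avoiders (Suc a) (b - 1)"
  then show "q \<in> {p \<in> cyclic_avoiders a b. p a = b}"
    using ab by (auto simp: cyclic_avoiders_def lift_perm_permutes cyclic_on_lift_perm_iff
        at_most_one_larger_right_lift_perm_iff lift_perm_apply simp del: One_nat_def)
next
  fix q assume "q \<in> {p \<in> cyclic_avoiders a b. p a = b}"
  then have q: "q \<in> cyclic_avoiders a b" "q a = b" by auto
  then have perm: "q permutes {a..b}" by (simp add: cyclic_avoiders_def)
  have qb: "q (b - 1) = a"
    using cyclic_avoiders_min_position[OF q(1) ab] cyclic_avoiders_extremes[OF q(1) ab] q(2) by blast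
  \<comment> \<open>Undoes the two transpositions of \<open>lift_perm\<close> in reverse order.
    Since \<open>q a = b\<close> and \<open>q (b - 1) = a\<close>, the result fixes \<open>a\<close>
    and \<open>b\<close>, hence permutes the inner interval.\<close>
  define p where "p = q \<circ> transpose (b - 1) a \<circ> transpose (b - 1) b"
  have lift: "lift_perm a b p = q" by (simp add: lift_perm_def p_def comp_assoc)
  have "p permutes {a..b}"
    unfolding p_def using ab perm by (intro permutes_compose permutes_swap_id) auto
  moreover have "p a = a" "p b = b" using ab q(2) qb by (auto simp: p_def transpose_def)
  ultimately have p: "p permutes {Suc a..b - 1}"
    by (elim permutes_superset) (metis Diff_iff atLeastAtMost_iff insertE insert_extremes[OF ab])
  have "p \<in> cyclic_avoiders (Suc a) (b - 1)"
    using q(1) p cyclic_on_lift_perm_iff[OF p ab] at_most_one_larger_right_lift_perm_iff[OF p ab]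
    by (simp add: cyclic_avoiders_def lift)
  with lift show "q \<in> lift_perm a b ` cyclic_avoiders (Suc a) (b - 1)" by blast
qed

section \<open>Counting by recursion\<close>

text \<open>The classes \<open>p a = b\<close> and \<open>p b = a\<close> partition the avoiders and
  are exchanged by inversion; \<open>lift_perm\<close> counts the first one.\<close>

lemma card_cyclic_avoiders_step:
  assumes ab: "a + 2 \<le> b"
  shows "card (cyclic_avoiders a b) = 2 * card (cyclic_avoiders (Suc a) (b - 1))"
proof -
  let ?A = "{p \<in> cyclic_avoiders a b. p a = b}" and ?B = "{p \<in> cyclic_avoiders a b. p b = a}"
  have "bij_betw inv ?A ?B"
  proof (rule bij_betw_byWitness[where f' = inv])
    have perm: "p permutes {a..b}" if "p \<in> cyclic_avoiders a b" for p
      using that by (simp add: cyclic_avoiders_def)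
    show "\<forall>p\<in>?A. inv (inv p) = p" "\<forall>p\<in>?B. inv (inv p) = p"
      using permutes_inv_inv[OF perm] by blast+
    show "inv ` ?A \<subseteq> ?B" "inv ` ?B \<subseteq> ?A"
      using permutes_inv_eq[OF perm] inv_cyclic_avoiders by blast+
  qed
  then have AB: "card ?A = card ?B" by (rule bij_betw_same_card)
  have union: "?A \<union> ?B = cyclic_avoiders a b" and disjoint: "?A \<inter> ?B = {}"
    using cyclic_avoiders_extremes[OF _ ab] by blast+
  have "card (?A \<union> ?B) = card ?A + card ?B"
    using finite_cyclic_avoiders[of a b] by (intro card_Un_disjoint disjoint) simp_all
  then have "card (cyclic_avoiders a b) = 2 * card ?A" unfolding union using AB by simp
  also have "card ?A = card (cyclic_avoiders (Suc a) (b - 1))"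
    unfolding lift_perm_image_cyclic_avoiders[OF ab, symmetric]
    by (rule card_image) (rule inj_on_subset[OF inj_lift_perm], simp)
  finally show ?thesis .
qed

lemma cyclic_avoiders_singleton: "cyclic_avoiders a a = {id}"
proof -
  have "at_most_one_larger_right {a} p" for p :: "nat \<Rightarrow> nat"
    by (simp add: at_most_one_larger_right_def)
  then show ?thesis by (auto simp: cyclic_avoiders_def cyclic_on_id_singleton)
qed

lemma cyclic_avoiders_doubleton: "cyclic_avoiders a (Suc a) = {transpose a (Suc a)}"
proof -
  have eq: "{a..Suc a} = {a, Suc a}" by auto
  have "\<not> cyclic_on id {a, Suc a}"
    using cyclic_on_two_cycle[of id "{a, Suc a}" a a] by auto
  moreover have "cyclic_on (transpose a (Suc a)) {a, Suc a}"
    \<comment> \<open>The 2-cycle arises by splicing \<open>Suc a\<close> into the one-point cycle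
      at \<open>a\<close>.\<close>
    using cyclic_on_comp_transpose_iff[of id "{a}" a "Suc a"] cyclic_on_id_singleton[of a]
    by (simp add: insert_commute)
  moreover have "at_most_one_larger_right {a, Suc a} p" for p :: "nat \<Rightarrow> nat"
    by (auto simp: at_most_one_larger_right_def)
  ultimately show ?thesis
    unfolding cyclic_avoiders_def eq
    by (auto simp: permutes_doubleton_iff permutes_swap_id)
qed

text \<open>The interval has \<open>n + 1\<close> points, so \<open>n\<close> plays the part of the
  length minus one. The induction steps by two from the one- and two-point intervals, with
  \<open>a\<close> arbitrary because each step raises the left end.\<close>

lemma card_cyclic_avoiders: "card (cyclic_avoiders a (a + n)) = 2 ^ (n div 2)"
proof (induction n arbitrary: a rule: less_induct)
  case (less n)
  consider "n = 0" | "n = 1" | m where "n = m + 2"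
    by (metis One_nat_def Suc_1 add.commute le_Suc_ex less_2_cases not_less)
  then show ?case
  proof cases
    case 3
    then have "card (cyclic_avoiders a (a + n)) = 2 * card (cyclic_avoiders (Suc a) (Suc a + m))"
      using card_cyclic_avoiders_step[of a "a + n"] by simp
    then show ?thesis using 3 less[of m "Suc a"] by simp
  qed (simp_all add: cyclic_avoiders_singleton cyclic_avoiders_doubleton)
qed

theorem theorem19:
  fixes n :: nat
  assumes "n \<ge> 3"
  shows "num_cyclic_avoiding n {[1, 2, 3], [1, 3, 2]} = 2 ^ ((n - 1) div 2)"
proof -
  have "{p. cyclic_permutation n p \<and> (\<forall>q\<in>{[1, 2, 3], [1, 3, 2]}. avoids_pattern n p q)} =
        cyclic_avoiders 1 n"
    unfolding cyclic_avoiders_def cyclic_permutation_def using avoids_123_132_iff by blast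
  then show ?thesis
    using card_cyclic_avoiders[of 1 "n - 1"] assms by (simp add: num_cyclic_avoiding_def)
qed

end
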